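(* Let $n,m\in\mathbb{N}$, $S\subseteq\mathbb{Z}^n$, $x(0)\in S$, and let $\mathcal{U}=\{u_1,\ldots,u_{|\mathcal{U}|}\}\subseteq\mathbb{Z}^n$ be finite. Let $G=(V,E)$ be the directed graph with $V=\mathbb{Z}^n$ and $E=\{(x,y)\mid y-x\in\mathcal{U}\}$. Assume that $$\operatorname{mindeg}(G_{\hat{S}})\geq m\ln\left(m|\hat{S}|\right)$$ holds for a finite induced subgraph $G_{\hat{S}}=(\hat{S},E_{\hat{S}})\subseteq G$ with $x(0)\in\hat{S}\subseteq S$. Let $\hat{l}:\mathcal{U}\to[m]$ and $l:E_{\hat{S}}\to[m]$ be labelings produced by the greedy labeling algorithm described in the context. Then $G_{\hat{S}}$ and $l$ satisfy the following properties: (C1) $x(0)\in\hat{S}$; (C2) for all $x\in\hat{S}$, $l\left(\{(x,x')\in E_{\hat{S}}\mid x'\in\hat{S}\}\right)=[m]$; (C3) if $(x,y),(x',y')\in E_{\hat{S}}$ satisfy $y-x=y'-x'$, then $l(x,y)=l(x',y')$.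
   Context: Notation: $\mathbb{N}$ is the set of strictly positive integers, $[m]=\{1,\ldots,m\}$, $|\cdot|$ is cardinality. The induced subgraph $G_{\hat{S}}$ has vertex set $\hat{S}$ and edge set $E_{\hat{S}}=\{(x,y)\in E\mid x,y\in\hat{S}\}$ (loops are included if $0\in\mathcal{U}$). For a set $A$ of edges, $l(A)$ is the image of $A$ under $l$. $\operatorname{mindeg}(G_{\hat{S}})$ is the minimal outgoing degree in $G_{\hat{S}}$ of any vertex in $\hat{S}$. Probability space: each $u\in\mathcal{U}$ receives a random label $\hat{l}(u)\in[m]$, chosen independently and uniformly, and $l:E_{\hat{S}}\to[m]$ is given by $l(x,y)=\hat{l}(y-x)$. For $x\in\hat{S}$ and $j\in[m]$, $B_x^j$ denotes the event that $j\notin l(\{(x,x')\in E_{\hat{S}}\mid x'\in\hat{S}\})$. $\Pr$ denotes probability in this space. Greedy labeling algorithm: define labels $l_1,\ldots,l_{|\mathcal{U}|}\in[m]$ inductively, for $i=1,2,\ldots,|\mathcal{U}|$, by choosing $$l_i\in\operatorname*{argmin}_{l'\in[m]}\sum_{x\in\hat{S},\,j\in[m]}\Pr\left(B_x^j\,\middle|\,\hat{l}(u_1)=l_1,\ldots,\hat{l}(u_{i-1})=l_{i-1},\hat{l}(u_i)=l'\right)$$ (any minimizer may be chosen). The output is the (deterministic) labeling $\hat{l}(u_i)=l_i$ for $i=1,\ldots,|\mathcal{U}|$, together with $l:E_{\hat{S}}\to[m]$ given by $l(x,y)=\hat{l}(y-x)$ for all $(x,y)\in E_{\hat{S}}$.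
   Formalization: The hypothesis mindeg(G_Ŝ) > 0 is added: without it (C2) fails when m = 1, Ŝ = {x(0)} and 0 ∉ U, where mindeg = 0 = m ln(m|Ŝ|) but x(0) has no outgoing edge; whenever m|Ŝ| > 1 it follows from the assumed bound. *)

theory Defs
  imports
    "HOL-Probability.Probability"
    "HOL-Probability.Product_PMF"
    "Graph_Theory.Graph_Theory"
begin

definition diff_digraph ::
    "'v::ab_group_add set \<Rightarrow> ('v, 'v \<times> 'v) pre_digraph" where
  "diff_digraph U = with_proj \<lparr> pverts = UNIV, parcs = {(x, y). y - x \<in> U} \<rparr>"

definition mindeg :: "('v, 'e) pre_digraph \<Rightarrow> nat" where
  "mindeg G = Min (out_degree G ` verts G)"

text \<open>
  A labelling of \<open>U\<close> is a function on the whole type. Product measures of pmfs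
  need a default value outside \<open>U\<close>; the value \<open>0\<close> chosen here is irrelevant, because only
  labels of differences lying in \<open>U\<close> are ever inspected.
\<close>

definition random_labels :: "nat \<Rightarrow> 'v set \<Rightarrow> ('v \<Rightarrow> nat) pmf" where
  "random_labels m U = Pi_pmf U 0 (\<lambda>_. pmf_of_set {1..m})"

definition edge_label :: "('v::ab_group_add \<Rightarrow> nat) \<Rightarrow> 'v \<times> 'v \<Rightarrow> nat" where
  "edge_label lh = (\<lambda>(x, y). lh (y - x))"

text \<open>
  The event \<open>B\<close> for \<open>x\<close> and \<open>j\<close>, as a predicate on the outcome \<open>lh\<close>:
  no edge of \<open>G\<close> leaving \<open>x\<close> carries the label \<open>j\<close>.
\<close>

definition missing ::
    "('v::ab_group_add, 'v \<times> 'v) pre_digraph \<Rightarrow> 'v \<Rightarrow> nat \<Rightarrow> ('v \<Rightarrow> nat) \<Rightarrow> bool" where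
  "missing G x j lh \<longleftrightarrow> j \<notin> edge_label lh ` out_arcs G x"

text \<open>
  The quantity minimised in step \<open>i\<close>. The enumeration \<open>u\<close> of \<open>U\<close> and the sequence \<open>lab\<close> of
  chosen labels are indexed from \<open>1\<close>.
\<close>

definition greedy_cost ::
    "nat \<Rightarrow> 'v::ab_group_add set \<Rightarrow> (nat \<Rightarrow> 'v) \<Rightarrow> 'v set \<Rightarrow> (nat \<Rightarrow> nat) \<Rightarrow> nat \<Rightarrow> nat \<Rightarrow> real" where
  "greedy_cost m U u Sh lab i l' =
     (\<Sum>x\<in>Sh. \<Sum>j\<in>{1..m}.
        \<P>(lh in measure_pmf (random_labels m U).
            missing (diff_digraph U \<restriction> Sh) x j lh \<bar>
            (\<forall>k\<in>{1..<i}. lh (u k) = lab k) \<and> lh (u i) = l'))"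

definition greedy_labels ::
    "nat \<Rightarrow> 'v::ab_group_add set \<Rightarrow> (nat \<Rightarrow> 'v) \<Rightarrow> 'v set \<Rightarrow> (nat \<Rightarrow> nat) \<Rightarrow> bool" where
  "greedy_labels m U u Sh lab \<longleftrightarrow>
     (\<forall>i\<in>{1..card U}. is_arg_min (greedy_cost m U u Sh lab i) (\<lambda>l'. l' \<in> {1..m}) (lab i))"

definition greedy_output ::
    "nat \<Rightarrow> 'v::ab_group_add set \<Rightarrow> (nat \<Rightarrow> 'v) \<Rightarrow> 'v set \<Rightarrow>
     ('v \<Rightarrow> nat) \<Rightarrow> ('v \<times> 'v \<Rightarrow> nat) \<Rightarrow> bool" where
  "greedy_output m U u Sh lh l \<longleftrightarrow>
     (\<exists>lab. greedy_labels m U u Sh lab \<and>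
            (\<forall>i\<in>{1..card U}. lh (u i) = lab i) \<and>
            (\<forall>e\<in>arcs (diff_digraph U \<restriction> Sh). l e = edge_label lh e))"

end

theory Submission
  imports Defs
begin

text \<open>
  The method of conditional expectations. The cost of a partial labelling is the expected number
  of pairs \<open>(x, j)\<close> such that no edge leaving \<open>x\<close> carries the label \<open>j\<close>, given the labels
  chosen so far. It is the average of the costs of the \<open>m\<close> possible next labels, so a greedy
  choice never increases it. Initially it is at most \<open>m |Sh| (1 - 1/m)^d < m |Sh| exp (- d/m) \<le> 1\<close>,
  where \<open>d > 0\<close> is the minimal out-degree. Once every label is chosen the cost is the actual
  number of such pairs, which is therefore \<open>0\<close>.
\<close>

section \<open>Out-neighbourhoods as sets of differences\<close>

text \<open>Recording out-neighbours by their differences places them inside \<open>U\<close>, so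
  distinct arcs leaving \<open>x\<close> read distinct, hence independent, coordinates of the random
  labelling.\<close>

definition label_neighbours :: "'v::ab_group_add set \<Rightarrow> 'v set \<Rightarrow> 'v \<Rightarrow> 'v set" where
  "label_neighbours U Sh x = {d \<in> U. x + d \<in> Sh}"

lemma out_arcs_induced_diff_digraph:
  assumes "x \<in> Sh"
  shows "out_arcs (diff_digraph U \<restriction> Sh) x = (\<lambda>d. (x, x + d)) ` label_neighbours U Sh x"
proof -
  have "out_arcs (diff_digraph U \<restriction> Sh) x = {(x, y) | y. y \<in> Sh \<and> y - x \<in> U}"
    using assms by (auto simp: diff_digraph_def induce_subgraph_def out_arcs_def)
  also have "\<dots> = (\<lambda>d. (x, x + d)) ` label_neighbours U Sh x"
  proof (intro equalityI subsetI)
    fix e assume "e \<in> {(x, y) | y. y \<in> Sh \<and> y - x \<in> U}"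
    then have "e = (x, x + (snd e - x))" "snd e - x \<in> label_neighbours U Sh x"
      by (auto simp: label_neighbours_def)
    then show "e \<in> (\<lambda>d. (x, x + d)) ` label_neighbours U Sh x"
      by (rule image_eqI)
  qed (auto simp: label_neighbours_def)
  finally show ?thesis .
qed

lemma out_degree_induced_diff_digraph:
  "x \<in> Sh \<Longrightarrow> out_degree (diff_digraph U \<restriction> Sh) x = card (label_neighbours U Sh x)"
  by (simp add: out_degree_def out_arcs_induced_diff_digraph card_image inj_on_def)

lemma missing_iff:
  "x \<in> Sh \<Longrightarrow> missing (diff_digraph U \<restriction> Sh) x j f \<longleftrightarrow> (\<forall>d\<in>label_neighbours U Sh x. f d \<noteq> j)"
  by (auto simp: missing_def edge_label_def out_arcs_induced_diff_digraph image_image)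

lemma mindeg_le_card_label_neighbours:
  assumes "finite Sh" "x \<in> Sh"
  shows "mindeg (diff_digraph U \<restriction> Sh) \<le> card (label_neighbours U Sh x)"
proof -
  have "mindeg (diff_digraph U \<restriction> Sh) \<le> out_degree (diff_digraph U \<restriction> Sh) x"
    unfolding mindeg_def using assms by (intro Min_le) (auto simp: induce_subgraph_def)
  then show ?thesis
    using assms by (simp add: out_degree_induced_diff_digraph)
qed

section \<open>Probabilities of product events\<close>

lemma prob_random_labels_Pi:
  assumes "finite U"
  shows "measure_pmf.prob (random_labels m U) (Pi U A) =
    (\<Prod>d\<in>U. measure_pmf.prob (pmf_of_set {1..m}) (A d))"
  unfolding random_labels_def using assms by (rule measure_Pi_pmf_Pi)

text \<open>The event is a box: coordinates in \<open>label_neighbours U Sh x\<close> avoid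
  \<open>j\<close>, the others are free, and independence gives a product.\<close>

lemma prob_missing:
  assumes "m \<ge> 1" "finite U" "x \<in> Sh" "j \<in> {1..m}"
  shows "measure_pmf.prob (random_labels m U) {f. missing (diff_digraph U \<restriction> Sh) x j f} =
    (1 - 1 / real m) ^ card (label_neighbours U Sh x)"
proof -
  let ?D = "label_neighbours U Sh x"
  have D: "?D \<subseteq> U"
    by (auto simp: label_neighbours_def)
  have "{f. missing (diff_digraph U \<restriction> Sh) x j f} = Pi U (\<lambda>d. if d \<in> ?D then - {j} else UNIV)"
    using D by (auto simp: missing_iff[OF assms(3)] Pi_iff split: if_splits)
  then have "measure_pmf.prob (random_labels m U) {f. missing (diff_digraph U \<restriction> Sh) x j f} =
    (\<Prod>d\<in>U. measure_pmf.prob (pmf_of_set {1..m}) (if d \<in> ?D then - {j} else UNIV))"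
    by (simp only: prob_random_labels_Pi[OF assms(2)])
  also have "\<dots> = (\<Prod>d\<in>U. if d \<in> ?D then 1 - 1 / real m else 1)"
  proof (rule prod.cong)
    have "measure_pmf.prob (pmf_of_set {1..m}) {j} = 1 / real m"
      using assms by (subst measure_pmf_of_set) auto
    then show "measure_pmf.prob (pmf_of_set {1..m}) (if d \<in> ?D then - {j} else UNIV) =
        (if d \<in> ?D then 1 - 1 / real m else 1)" for d
      using measure_pmf.prob_compl[of "{j}" "pmf_of_set {1..m}"] by (simp add: Compl_eq_Diff_UNIV)
  qed simp
  also have "\<dots> = (1 - 1 / real m) ^ card ?D"
    using assms(2) D by (simp add: prod.If_cases Int_absorb1)
  finally show ?thesis .
qed

section \<open>Conditioning on the labels chosen so far\<close>

definition agree :: "(nat \<Rightarrow> 'v) \<Rightarrow> (nat \<Rightarrow> nat) \<Rightarrow> nat \<Rightarrow> ('v \<Rightarrow> nat) set" where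
  "agree u lab i = {f. \<forall>k\<in>{1..i}. f (u k) = lab k}"

lemma prob_agree:
  assumes "finite U" "bij_betw u {1..card U} U" "i \<le> card U" "\<And>k. k \<in> {1..i} \<Longrightarrow> lab k \<in> {1..m}"
  shows "measure_pmf.prob (random_labels m U) (agree u lab i) = (1 / real m) ^ i"
proof -
  have inj: "inj_on u {1..card U}"
    using assms(2) by (simp add: bij_betw_def)
  \<comment> \<open>Quantifying over all \<open>k\<close> with \<open>u k = d\<close> avoids
    inverting \<open>u\<close>; by injectivity each side \<open>A (u k)\<close> of the box is a
    singleton or everything.\<close>
  define A where "A d = {a. \<forall>k\<in>{1..i}. u k = d \<longrightarrow> a = lab k}" for d
  have "agree u lab i = Pi U A"
  proof -
    have "u k \<in> U" if "k \<in> {1..i}" for k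
      using that assms(2,3) bij_betwE by fastforce
    then have "(\<forall>k\<in>{1..i}. f (u k) = lab k) \<longleftrightarrow> (\<forall>d\<in>U. \<forall>k\<in>{1..i}. u k = d \<longrightarrow> f d = lab k)" for f
      by metis
    then show ?thesis
      by (simp add: agree_def A_def Pi_def Ball_def)
  qed
  then have "measure_pmf.prob (random_labels m U) (agree u lab i) =
    (\<Prod>d\<in>U. measure_pmf.prob (pmf_of_set {1..m}) (A d))"
    by (simp only: prob_random_labels_Pi[OF assms(1)])
  also have "\<dots> = (\<Prod>k\<in>{1..card U}. measure_pmf.prob (pmf_of_set {1..m}) (A (u k)))"
    by (rule prod.reindex_bij_betw[OF assms(2), symmetric])
  also have "\<dots> = (\<Prod>k\<in>{1..card U}. if k \<in> {1..i} then 1 / real m else 1)"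
  proof (rule prod.cong)
    fix k assume k: "k \<in> {1..card U}"
    have eq: "u k' = u k \<longleftrightarrow> k' = k" if "k' \<in> {1..i}" for k'
      using that assms(3) by (intro inj_on_eq_iff[OF inj _ k]) auto
    show "measure_pmf.prob (pmf_of_set {1..m}) (A (u k)) = (if k \<in> {1..i} then 1 / real m else 1)"
    proof (cases "k \<in> {1..i}")
      case True
      then have "A (u k) = {lab k}"
        using eq by (auto simp: A_def)
      then show ?thesis
        using assms(4)[OF True] True by (subst measure_pmf_of_set) auto
    next
      case False
      then have "A (u k) = UNIV"
        using eq by (auto simp: A_def)
      then show ?thesis
        by (simp only: False if_False measure_pmf_UNIV)
    qed
  qed simp
  also have "\<dots> = (1 / real m) ^ i"
    using assms(3) by (simp add: prod.If_cases Int_absorb1 del: atLeastAtMost_iff)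
  finally show ?thesis .
qed

text \<open>The factor \<open>m ^ i\<close> is the reciprocal of the probability of \<open>agree u lab i\<close>.\<close>

definition label_cost ::
    "nat \<Rightarrow> 'v::ab_group_add set \<Rightarrow> (nat \<Rightarrow> 'v) \<Rightarrow> 'v set \<Rightarrow> (nat \<Rightarrow> nat) \<Rightarrow> nat \<Rightarrow> real" where
  "label_cost m U u Sh lab i = (\<Sum>x\<in>Sh. \<Sum>j\<in>{1..m}.
     real m ^ i * measure_pmf.prob (random_labels m U)
       ({f. missing (diff_digraph U \<restriction> Sh) x j f} \<inter> agree u lab i))"

lemma agree_Suc:
  "agree u lab (Suc i) = {f \<in> agree u lab i. f (u (Suc i)) = lab (Suc i)}"
  by (auto simp: agree_def atLeastAtMostSuc_conv)

lemma agree_upd [simp]: "agree u (lab(Suc i := a)) i = agree u lab i"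
  by (auto simp: agree_def)

text \<open>By \<open>prob_agree\<close> the conditioning event has probability
  \<open>(1 / m) ^ Suc i\<close>, which is nonzero, so dividing by it is multiplying by
  \<open>m ^ Suc i\<close>.\<close>

lemma greedy_cost_eq:
  assumes "finite U" "bij_betw u {1..card U} U" "i < card U"
    "\<And>k. k \<in> {1..i} \<Longrightarrow> lab k \<in> {1..m}" "a \<in> {1..m}"
  shows "greedy_cost m U u Sh lab (Suc i) a = label_cost m U u Sh (lab(Suc i := a)) (Suc i)"
proof -
  let ?lab = "lab(Suc i := a)"
  have E: "{f. (\<forall>k\<in>{1..<Suc i}. f (u k) = lab k) \<and> f (u (Suc i)) = a} = agree u ?lab (Suc i)"
    by (auto simp: agree_Suc) (auto simp: agree_def)
  have "measure_pmf.prob (random_labels m U) (agree u ?lab (Suc i)) = (1 / real m) ^ Suc i"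
    using assms by (intro prob_agree) auto
  then show ?thesis
    unfolding greedy_cost_def label_cost_def cond_prob_def
    by (simp add: E[symmetric] Collect_conj_eq power_divide mult.commute)
qed

text \<open>Law of total probability over the label of \<open>u (Suc i)\<close>; the factor
  \<open>m\<close> appears because the weight grows from \<open>m ^ i\<close> to
  \<open>m ^ Suc i\<close>.\<close>

lemma sum_label_cost:
  assumes "finite U" "bij_betw u {1..card U} U" "i < card U"
  shows "(\<Sum>a\<in>{1..m}. label_cost m U u Sh (lab(Suc i := a)) (Suc i)) =
    real m * label_cost m U u Sh lab i"
\<comment> \<open>For \<open>m = 0\<close> both sides vanish; otherwise \<open>{1..m}\<close> is
  nonempty and is the support of each random label.\<close>
proof (cases "m = 0")
  case False
  let ?P = "measure_pmf.prob (random_labels m U)"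
  let ?B = "\<lambda>x j. {f. missing (diff_digraph U \<restriction> Sh) x j f}"
  have "u (Suc i) \<in> U"
    using assms by (auto simp: bij_betw_def)
  then have range: "f (u (Suc i)) \<in> {1..m}" if "f \<in> set_pmf (random_labels m U)" for f
    using that assms(1) False
    by (auto simp: random_labels_def set_Pi_pmf PiE_dflt_def split: if_splits)
  have total: "(\<Sum>a\<in>{1..m}. ?P (?B x j \<inter> agree u (lab(Suc i := a)) (Suc i))) = ?P (?B x j \<inter> agree u lab i)"
    for x j
  proof -
    have "(\<Sum>a\<in>{1..m}. ?P (?B x j \<inter> agree u (lab(Suc i := a)) (Suc i))) =
      ?P (\<Union>a\<in>{1..m}. ?B x j \<inter> agree u (lab(Suc i := a)) (Suc i))"
      by (rule measure_pmf.finite_measure_finite_Union[symmetric])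
        (auto simp: disjoint_family_on_def agree_Suc)
    \<comment> \<open>The two events differ only by functions whose value at
      \<open>u (Suc i)\<close> lies outside \<open>{1..m}\<close>, a null set.\<close>
    also have "\<dots> = ?P (?B x j \<inter> agree u lab i)"
      using range by (intro measure_pmf.finite_measure_eq_AE) (auto simp: agree_Suc AE_measure_pmf_iff)
    finally show ?thesis .
  qed
  let ?t = "\<lambda>x j a. real m ^ Suc i * ?P (?B x j \<inter> agree u (lab(Suc i := a)) (Suc i))"
  have "(\<Sum>a\<in>{1..m}. label_cost m U u Sh (lab(Suc i := a)) (Suc i)) =
    (\<Sum>x\<in>Sh. \<Sum>a\<in>{1..m}. \<Sum>j\<in>{1..m}. ?t x j a)"
    unfolding label_cost_def by (rule sum.swap)
  also have "\<dots> = (\<Sum>x\<in>Sh. \<Sum>j\<in>{1..m}. \<Sum>a\<in>{1..m}. ?t x j a)"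
    by (rule sum.cong[OF refl]) (rule sum.swap)
  also have "\<dots> = (\<Sum>x\<in>Sh. \<Sum>j\<in>{1..m}. real m ^ Suc i * ?P (?B x j \<inter> agree u lab i))"
    by (simp only: sum_distrib_left[symmetric] total)
  finally show ?thesis
    by (simp add: label_cost_def sum_distrib_left mult.assoc)
qed simp

text \<open>A minimum over the \<open>m\<close> labels is at most their average, which by
  \<open>sum_label_cost\<close> is the previous cost.\<close>

lemma label_cost_greedy_le:
  assumes "m \<ge> 1" "finite U" "bij_betw u {1..card U} U" "greedy_labels m U u Sh lab" "i \<le> card U"
  shows "label_cost m U u Sh lab i \<le> label_cost m U u Sh lab 0"
  using assms(5)
proof (induction i)
  case (Suc i)
  have lab: "lab k \<in> {1..m}" if "k \<in> {1..card U}" for k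
    using assms(4) that by (auto simp: greedy_labels_def is_arg_min_def)
  have cost: "greedy_cost m U u Sh lab (Suc i) a = label_cost m U u Sh (lab(Suc i := a)) (Suc i)"
    if "a \<in> {1..m}" for a
    using assms Suc.prems that lab by (intro greedy_cost_eq) auto
  have "is_arg_min (greedy_cost m U u Sh lab (Suc i)) (\<lambda>a. a \<in> {1..m}) (lab (Suc i))"
    using assms(4) Suc.prems by (auto simp: greedy_labels_def)
  \<comment> \<open>\<open>lab\<close> is its own update at \<open>Suc i\<close> by
    \<open>lab (Suc i)\<close>, so its cost is the one that the greedy choice minimises.\<close>
  then have min: "label_cost m U u Sh lab (Suc i) \<le> label_cost m U u Sh (lab(Suc i := a)) (Suc i)"
    if "a \<in> {1..m}" for a
    using that cost[OF that] cost[of "lab (Suc i)"] unfolding is_arg_min_linorder by (metis fun_upd_triv)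
  have "(\<Sum>a\<in>{1..m}. label_cost m U u Sh lab (Suc i)) \<le>
    (\<Sum>a\<in>{1..m}. label_cost m U u Sh (lab(Suc i := a)) (Suc i))"
    using min by (rule sum_mono)
  also have "\<dots> = real m * label_cost m U u Sh lab i"
    using assms Suc.prems by (intro sum_label_cost) auto
  finally have "label_cost m U u Sh lab (Suc i) \<le> label_cost m U u Sh lab i"
    using assms(1) by simp
  then show ?case
    using Suc by simp
qed simp

section \<open>Initial bound and final cost\<close>

text \<open>Strictness comes from \<open>1 - t < exp (- t)\<close> at \<open>t = 1 / m\<close> and
  survives the power because \<open>d > 0\<close>. For \<open>m = s = 1\<close> the logarithm is 0,
  and \<open>d = 0\<close> would give the value 1.\<close>

lemma one_minus_inverse_power_less:
  fixes m s d :: nat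
  assumes "m \<ge> 1" "s \<ge> 1" "d > 0" "real d \<ge> real m * ln (real m * real s)"
  shows "real m * real s * (1 - 1 / real m) ^ d < 1"
proof -
  have "1 - 1 / real m < exp (- (1 / real m))"
    using exp_minus_greater[of "1 / real m"] assms(1) by simp
  then have "(1 - 1 / real m) ^ d < exp (- (1 / real m)) ^ d"
    using assms by (intro power_strict_mono) auto
  also have "\<dots> = exp (- (real d / real m))"
    by (simp add: exp_of_nat_mult[symmetric])
  also have "\<dots> \<le> exp (- ln (real m * real s))"
    using assms by (simp add: pos_le_divide_eq mult.commute)
  also have "\<dots> = 1 / (real m * real s)"
    using assms by (simp add: exp_minus inverse_eq_divide)
  finally show ?thesis
    using assms by (simp add: pos_less_divide_eq mult.commute)
qed

text \<open>At stage 0 nothing is conditioned on: \<open>agree u lab 0\<close> is the whole space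
  and the weight is 1, so \<open>prob_missing\<close> evaluates every summand.\<close>

lemma label_cost_0_less_1:
  assumes "m \<ge> 1" "finite U" "finite Sh" "Sh \<noteq> {}"
    and "real (mindeg (diff_digraph U \<restriction> Sh)) \<ge> real m * ln (real m * real (card Sh))"
    and "mindeg (diff_digraph U \<restriction> Sh) > 0"
  shows "label_cost m U u Sh lab 0 < 1"
proof -
  let ?d = "mindeg (diff_digraph U \<restriction> Sh)"
  have "label_cost m U u Sh lab 0 =
    (\<Sum>x\<in>Sh. \<Sum>j\<in>{1..m}. (1 - 1 / real m) ^ card (label_neighbours U Sh x))"
    using assms by (simp add: label_cost_def agree_def prob_missing)
  \<comment> \<open>The base lies in \<open>[0, 1]\<close>, so lowering each exponent to the minimal
    degree cannot decrease the sum.\<close>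
  also have "\<dots> \<le> (\<Sum>x\<in>Sh. \<Sum>j\<in>{1..m}. (1 - 1 / real m) ^ ?d)"
    using assms by (intro sum_mono power_decreasing mindeg_le_card_label_neighbours) auto
  also have "\<dots> = real m * real (card Sh) * (1 - 1 / real m) ^ ?d"
    by simp
  also have "\<dots> < 1"
    using assms by (intro one_minus_inverse_power_less) (auto simp: Suc_le_eq card_gt_0_iff)
  finally show ?thesis .
qed

text \<open>Once all labels are fixed, a missing pair contributes exactly 1 to the cost, and no
  summand is negative.\<close>

lemma not_missing_if_label_cost_less_1:
  assumes "m \<ge> 1" "finite U" "bij_betw u {1..card U} U" "finite Sh" "x \<in> Sh" "j \<in> {1..m}"
    and lab: "\<And>k. k \<in> {1..card U} \<Longrightarrow> lab k \<in> {1..m}"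
    and f: "f \<in> agree u lab (card U)"
    and cost: "label_cost m U u Sh lab (card U) < 1"
  shows "\<not> missing (diff_digraph U \<restriction> Sh) x j f"
proof
  assume missing: "missing (diff_digraph U \<restriction> Sh) x j f"
  let ?n = "card U"
  let ?B = "\<lambda>x j. {g. missing (diff_digraph U \<restriction> Sh) x j g}"
  let ?t = "\<lambda>x j. real m ^ ?n * measure_pmf.prob (random_labels m U) (?B x j \<inter> agree u lab ?n)"
  have img: "U = u ` {1..?n}"
    using assms(3) by (simp add: bij_betw_def)
  \<comment> \<open>\<open>missing\<close> reads labels on \<open>U\<close> only, so it has the same
    truth value on all of \<open>agree u lab ?n\<close>.\<close>
  have "g d = f d" if g: "g \<in> agree u lab ?n" and d: "d \<in> U" for g d
  proof -
    obtain k where "k \<in> {1..?n}" "d = u k"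
      using d img by blast
    then show ?thesis
      using f g by (simp add: agree_def)
  qed
  then have "agree u lab ?n \<subseteq> ?B x j"
    using missing by (auto simp: missing_iff[OF assms(5)] label_neighbours_def)
  then have "?B x j \<inter> agree u lab ?n = agree u lab ?n"
    by auto
  moreover have "measure_pmf.prob (random_labels m U) (agree u lab ?n) = (1 / real m) ^ ?n"
    using assms(2,3) order_refl lab by (rule prob_agree)
  ultimately have "1 = ?t x j"
    using assms(1) by (simp add: power_divide)
  also have "\<dots> \<le> (\<Sum>j\<in>{1..m}. ?t x j)"
    using assms by (intro member_le_sum) auto
  also have "\<dots> \<le> (\<Sum>x\<in>Sh. \<Sum>j\<in>{1..m}. ?t x j)"
    using assms by (intro member_le_sum[of x Sh "\<lambda>x. \<Sum>j\<in>{1..m}. ?t x j"] sum_nonneg) auto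
  also have "\<dots> = label_cost m U u Sh lab ?n"
    by (simp add: label_cost_def)
  finally show False
    using cost by simp
qed

theorem theorem3:
  fixes m :: nat
    and S Sh U :: "(int ^ 'n) set"
    and x0 :: "int ^ 'n"
    and u :: "nat \<Rightarrow> int ^ 'n"
    and lh :: "int ^ 'n \<Rightarrow> nat"
    and l :: "(int ^ 'n) \<times> (int ^ 'n) \<Rightarrow> nat"
  assumes "m \<ge> 1"
    and "x0 \<in> S"
    and "finite U" and "bij_betw u {1..card U} U"
    and "finite Sh" and "x0 \<in> Sh" and "Sh \<subseteq> S"
    and "real (mindeg (diff_digraph U \<restriction> Sh)) \<ge> real m * ln (real m * real (card Sh))"
    and nondegenerate: "mindeg (diff_digraph U \<restriction> Sh) > 0"
    and "greedy_output m U u Sh lh l"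
  shows "x0 \<in> Sh \<and>
    (\<forall>x\<in>Sh. l ` {(x, x') | x'. x' \<in> Sh \<and> (x, x') \<in> arcs (diff_digraph U \<restriction> Sh)} = {1..m}) \<and>
    (\<forall>x y x' y'. (x, y) \<in> arcs (diff_digraph U \<restriction> Sh) \<longrightarrow>
       (x', y') \<in> arcs (diff_digraph U \<restriction> Sh) \<longrightarrow> y - x = y' - x' \<longrightarrow> l (x, y) = l (x', y'))"
proof -
  let ?G = "diff_digraph U \<restriction> Sh"
  obtain lab where greedy: "greedy_labels m U u Sh lab"
    and lh: "\<And>i. i \<in> {1..card U} \<Longrightarrow> lh (u i) = lab i"
    and l: "\<And>e. e \<in> arcs ?G \<Longrightarrow> l e = edge_label lh e"
    using assms(10) by (auto simp: greedy_output_def)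
  have lab: "lab i \<in> {1..m}" if "i \<in> {1..card U}" for i
    using greedy that by (auto simp: greedy_labels_def is_arg_min_def)
  have "U = u ` {1..card U}"
    using assms(4) by (simp add: bij_betw_def)
  then have lh_range: "lh d \<in> {1..m}" if "d \<in> U" for d
    using that lh lab by (metis imageE)
  have "label_cost m U u Sh lab (card U) \<le> label_cost m U u Sh lab 0"
    using assms(1,3,4) greedy by (intro label_cost_greedy_le) auto
  also have "\<dots> < 1"
    using assms(1,3,5,6,8) nondegenerate by (intro label_cost_0_less_1) auto
  \<comment> \<open>\<open>lh\<close> lies in \<open>agree u lab (card U)\<close>; its values off
    \<open>U\<close> are arbitrary and never read.\<close>
  finally have hit: "\<not> missing ?G x j lh" if "x \<in> Sh" "j \<in> {1..m}" for x j
    using assms(1,3,4,5) that lab lh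
    by (intro not_missing_if_label_cost_less_1) (auto simp: agree_def)
  \<comment> \<open>\<open>l\<close> may be replaced by \<open>edge_label lh\<close> since only arcs
    occur. One inclusion is \<open>lh_range\<close>, the other is \<open>hit\<close>.\<close>
  have "l ` {(x, x') | x'. x' \<in> Sh \<and> (x, x') \<in> arcs ?G} = {1..m}" if x: "x \<in> Sh" for x
  proof -
    have "{(x, x') | x'. x' \<in> Sh \<and> (x, x') \<in> arcs ?G} = out_arcs ?G x"
      by (auto simp: diff_digraph_def induce_subgraph_def out_arcs_def)
    moreover have "l ` out_arcs ?G x = edge_label lh ` out_arcs ?G x"
      using l by (intro image_cong) auto
    moreover have "edge_label lh ` out_arcs ?G x \<subseteq> {1..m}"
      using lh_range
      by (auto simp: out_arcs_induced_diff_digraph[OF x] edge_label_def label_neighbours_def simp del: atLeastAtMost_iff)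
    moreover have "{1..m} \<subseteq> edge_label lh ` out_arcs ?G x"
      using hit[OF x] by (auto simp: missing_def)
    ultimately show ?thesis
      by simp
  qed
  moreover have "l (x, y) = l (x', y')"
    if "(x, y) \<in> arcs ?G" "(x', y') \<in> arcs ?G" "y - x = y' - x'" for x y x' y'
    using that by (simp add: l edge_label_def)
  ultimately show ?thesis
    using assms(6) by blast
qed

end
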